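(* Let $m\le n$ and $t<\frac m4-2$ be positive integers, and let $L_f>0$. For any first-order method $\mathcal M$ (as defined in the context), there exists an instance of the bilinear saddle-point problem $\min_{x\in X}\max_{y\in Y} f(x)+\langle Ax-b,y\rangle-g(y)$ (with $A\in\mathbb R^{m\times n}$) such that $\nabla f$ is $L_f$-Lipschitz continuous, $X$ and $Y$ are Euclidean balls with radii $R_X$ and $R_Y$ respectively (the radii being part of the instance), and $$\phi(\bar x^{(t)})-\psi(\bar y^{(t)})\ \ge\ \frac{L_fR_X^2}{16(4t+9)^2}+\left(\frac{\sqrt2+2}{4}\right)\frac{\|A\|R_XR_Y}{4t+9},$$ where $\phi$ and $\psi$ are the associated primal and dual objective functions and $(\bar x^{(t)},\bar y^{(t)})$ is the approximate solution output by $\mathcal M$ applied to the instance. In addition, given $\mu>0$, there exists an instance of the bilinear saddle-point problem such that $f$ is $\mu$-strongly convex, $X$ and $Y$ are Euclidean balls with radii $R_X$ and $R_Y$ respectively, and $$\phi(\bar x^{(t)})-\psi(\bar y^{(t)})\ \ge\ \frac{5\|A\|^2R_Y^2}{512\,\mu(4t+9)^2}.$$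
   Context: $\|\cdot\|$ is the Euclidean norm of vectors and the spectral norm of matrices. Bilinear saddle-point problem: $\min_{x\in X}\max_{y\in Y} f(x)+\langle Ax-b,y\rangle-g(y)$, with $X\subseteq\mathbb R^n$, $Y\subseteq\mathbb R^m$ closed convex, $f:\mathbb R^n\to\mathbb R$, $g:\mathbb R^m\to\mathbb R$ closed convex, $f$ differentiable with Lipschitz gradient, $A\in\mathbb R^{m\times n}$, $b\in\mathbb R^m$. Primal objective: $\phi(x)=f(x)+\max_{y\in Y}\{\langle Ax-b,y\rangle-g(y)\}$. Dual objective: $\psi(y)=-g(y)+\min_{x\in X}\{\langle Ax-b,y\rangle+f(x)\}$. $f$ is $\mu$-strongly convex if $\langle\nabla f(x_1)-\nabla f(x_2),x_1-x_2\rangle\ge\mu\|x_1-x_2\|^2$ for all $x_1,x_2\in\mathbb R^n$. First-order method: it accesses $f$ and $A$ only through the oracle $\mathcal O(x,y)=(\nabla f(x),Ax,A^\top y)$. A first-order method $\mathcal M$ consists of an initial point $(x^{(0)},y^{(0)})\in X\times Y$ and a sequence of (deterministic) rules $\mathcal I_t$, $t\ge0$, with $$(x^{(t+1)},y^{(t+1)},\bar x^{(t+1)},\bar y^{(t+1)})=\mathcal I_t\big(\theta;\mathcal O(x^{(0)},y^{(0)}),\dots,\mathcal O(x^{(t)},y^{(t)})\big),$$ where $(x^{(t)},y^{(t)})\in X\times Y$ are inquiry points, $(\bar x^{(t)},\bar y^{(t)})\in X\times Y$ is the approximate solution output, and $\theta$ denotes all remaining information of the problem, which is fully known to $\mathcal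 M$: $X$, $Y$, $g$, $b$, the Lipschitz constant $L_f$ and its associated norm (the initial point may depend on $\theta$). *)

theory Defs
  imports "HOL-Analysis.Analysis"
begin

text \<open>
  The data of a bilinear saddle-point problem
    \<open>min\<^sub>x\<^sub>\<in>\<^sub>X max\<^sub>y\<^sub>\<in>\<^sub>Y  f x + \<langle>A x - b, y\<rangle> - g y\<close>
  is split into the part \<open>\<theta>\<close> that a first-order method knows completely
  and the pair \<open>(f, A)\<close>, which it sees only through the oracle. The dimensions are those of the
  index types, \<open>n = CARD('n)\<close> and \<open>m = CARD('m)\<close>. The norm to which the Lipschitz constant
  refers is always the Euclidean one, so it is not stored.
\<close>

record ('n::finite, 'm::finite) known_data =
  Xset :: "(real ^ 'n) set"
  Yset :: "(real ^ 'm) set"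
  gfun :: "real ^ 'm \<Rightarrow> real"
  bvec :: "real ^ 'm"
  Lconst :: real

definition gradient :: "('a::real_inner \<Rightarrow> real) \<Rightarrow> 'a \<Rightarrow> 'a" where
  "gradient f x = (THE d. GDERIV f x :> d)"

lemma gradient_eqI:
  assumes "GDERIV f x :> d"
  shows "gradient f x = d"
  unfolding gradient_def
proof (rule the_equality)
  fix d' assume "GDERIV f x :> d'"
  then have "(\<lambda>h. inner h d') = (\<lambda>h. inner h d)"
    using assms has_derivative_unique unfolding gderiv_def by blast
  then show "d' = d"
    by (metis inner_commute vector_eq_rdot)
qed (fact assms)

definition strongly_convex :: "real \<Rightarrow> ('a::real_inner \<Rightarrow> real) \<Rightarrow> bool" where
  "strongly_convex \<mu> f \<longleftrightarrow>
     (\<forall>x1 x2. (gradient f x1 - gradient f x2) \<bullet> (x1 - x2) \<ge> \<mu> * (norm (x1 - x2))\<^sup>2)"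

text \<open>A closed convex function is one whose epigraph is closed and convex.\<close>

definition closed_convex_fun :: "('a::real_normed_vector \<Rightarrow> real) \<Rightarrow> bool" where
  "closed_convex_fun f \<longleftrightarrow> convex_on UNIV f \<and> closed (epigraph UNIV f)"

text \<open>Nonemptiness of the feasible sets is needed for an initial point in \<open>X \<times> Y\<close> to exist.\<close>

definition bilinear_spp ::
    "('n::finite, 'm::finite) known_data \<Rightarrow> (real ^ 'n \<Rightarrow> real) \<Rightarrow> real ^ 'n ^ 'm \<Rightarrow> bool" where
  "bilinear_spp \<theta> f A \<longleftrightarrow>
     closed (Xset \<theta>) \<and> convex (Xset \<theta>) \<and> Xset \<theta> \<noteq> {} \<and>
     closed (Yset \<theta>) \<and> convex (Yset \<theta>) \<and> Yset \<theta> \<noteq> {} \<and>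
     closed_convex_fun f \<and> closed_convex_fun (gfun \<theta>) \<and>
     (\<forall>x. f differentiable (at x)) \<and> (Lconst \<theta>)-lipschitz_on UNIV (gradient f)"

text \<open>
  The inner maximum and minimum are written as supremum and infimum over the reals. They are
  attained, and hence agree with max and min, when \<open>Y\<close> respectively \<open>X\<close> is compact,
  because \<open>g\<close> and \<open>f\<close> are finite convex functions on the whole space and so continuous.
\<close>

definition primal_obj ::
    "('n::finite, 'm::finite) known_data \<Rightarrow> (real ^ 'n \<Rightarrow> real) \<Rightarrow> real ^ 'n ^ 'm \<Rightarrow> real ^ 'n \<Rightarrow> real" where
  "primal_obj \<theta> f A x = f x + (SUP y\<in>Yset \<theta>. (A *v x - bvec \<theta>) \<bullet> y - gfun \<theta> y)"

definition dual_obj ::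
    "('n::finite, 'm::finite) known_data \<Rightarrow> (real ^ 'n \<Rightarrow> real) \<Rightarrow> real ^ 'n ^ 'm \<Rightarrow> real ^ 'm \<Rightarrow> real" where
  "dual_obj \<theta> f A y = - gfun \<theta> y + (INF x\<in>Xset \<theta>. (A *v x - bvec \<theta>) \<bullet> y + f x)"

definition spectral_norm :: "real ^ 'n ^ 'm \<Rightarrow> real" where
  "spectral_norm A = onorm (\<lambda>x. A *v x)"

type_synonym ('n, 'm) answer = "(real ^ 'n) \<times> (real ^ 'm) \<times> (real ^ 'n)"

definition oracle_answer ::
    "(real ^ 'n \<Rightarrow> real) \<Rightarrow> real ^ 'n ^ 'm \<Rightarrow> (real ^ 'n) \<times> (real ^ 'm) \<Rightarrow> ('n::finite, 'm::finite) answer" where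
  "oracle_answer f A = (\<lambda>(x, y). (gradient f x, A *v x, transpose A *v y))"

text \<open>
  \<open>rule_of M s\<close> is the rule \<open>I\<^sub>s\<close>. Its result consists of the next inquiry point
  and the approximate solution, both with index \<open>s + 1\<close>.
\<close>

record ('n::finite, 'm::finite) fo_method =
  init_of :: "('n, 'm) known_data \<Rightarrow> (real ^ 'n) \<times> (real ^ 'm)"
  rule_of :: "nat \<Rightarrow> ('n, 'm) known_data \<Rightarrow> ('n, 'm) answer list \<Rightarrow>
     ((real ^ 'n) \<times> (real ^ 'm)) \<times> ((real ^ 'n) \<times> (real ^ 'm))"

text \<open>\<open>answers M \<theta> f A s\<close> lists the oracle answers at the inquiry points \<open>0, \<dots>, s\<close>.\<close>

primrec answers ::
    "('n::finite, 'm::finite) fo_method \<Rightarrow> ('n, 'm) known_data \<Rightarrow> (real ^ 'n \<Rightarrow> real) \<Rightarrow> real ^ 'n ^ 'm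
      \<Rightarrow> nat \<Rightarrow> ('n, 'm) answer list" where
  "answers M \<theta> f A 0 = [oracle_answer f A (init_of M \<theta>)]"
| "answers M \<theta> f A (Suc s) =
     answers M \<theta> f A s @ [oracle_answer f A (fst (rule_of M s \<theta> (answers M \<theta> f A s)))]"

primrec inquiry ::
    "('n::finite, 'm::finite) fo_method \<Rightarrow> ('n, 'm) known_data \<Rightarrow> (real ^ 'n \<Rightarrow> real) \<Rightarrow> real ^ 'n ^ 'm
      \<Rightarrow> nat \<Rightarrow> (real ^ 'n) \<times> (real ^ 'm)" where
  "inquiry M \<theta> f A 0 = init_of M \<theta>"
| "inquiry M \<theta> f A (Suc s) = fst (rule_of M s \<theta> (answers M \<theta> f A s))"

text \<open>
  No approximate solution is produced before the first rule is applied; the value at \<open>0\<close>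
  only makes the function total.
\<close>

primrec approx_sol ::
    "('n::finite, 'm::finite) fo_method \<Rightarrow> ('n, 'm) known_data \<Rightarrow> (real ^ 'n \<Rightarrow> real) \<Rightarrow> real ^ 'n ^ 'm
      \<Rightarrow> nat \<Rightarrow> (real ^ 'n) \<times> (real ^ 'm)" where
  "approx_sol M \<theta> f A 0 = init_of M \<theta>"
| "approx_sol M \<theta> f A (Suc s) = snd (rule_of M s \<theta> (answers M \<theta> f A s))"

lemma answers_eq_map_inquiry:
  "answers M \<theta> f A s = map (\<lambda>k. oracle_answer f A (inquiry M \<theta> f A k)) [0..<Suc s]"
  by (induction s) simp_all

definition first_order_method :: "('n::finite, 'm::finite) fo_method \<Rightarrow> bool" where
  "first_order_method M \<longleftrightarrow>
     (\<forall>\<theta> f A s. bilinear_spp \<theta> f A \<longrightarrow>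
        inquiry M \<theta> f A s \<in> Xset \<theta> \<times> Yset \<theta> \<and>
        approx_sol M \<theta> f A s \<in> Xset \<theta> \<times> Yset \<theta>)"

definition gap_at ::
    "('n::finite, 'm::finite) fo_method \<Rightarrow> ('n, 'm) known_data \<Rightarrow> (real ^ 'n \<Rightarrow> real) \<Rightarrow> real ^ 'n ^ 'm
      \<Rightarrow> nat \<Rightarrow> real" where
  "gap_at M \<theta> f A t =
     primal_obj \<theta> f A (fst (approx_sol M \<theta> f A t)) - dual_obj \<theta> f A (snd (approx_sol M \<theta> f A t))"

definition is_ball :: "'a::metric_space set \<Rightarrow> real \<Rightarrow> bool" where
  "is_ball S R \<longleftrightarrow> 0 < R \<and> (\<exists>c. S = cball c R)"

end

theory Submission
  imports Defs
begin

text \<open>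
  Take \<open>f x = c/2 \<parallel>x\<parallel>\<^sup>2\<close> (with \<open>c = 0\<close> for the first bound), \<open>g = 0\<close>, \<open>b\<close> a multiple of \<open>u\<^sub>0\<close> and
  \<open>A = \<Sum>\<^sub>j u\<^sub>j (v\<^sub>j - v\<^sub>j\<^sub>-\<^sub>1)\<^sup>T\<close> (with \<open>v\<^sub>-\<^sub>1 = 0\<close>) for orthonormal families \<open>u\<close>, \<open>v\<close> that an adversary chooses as the method
  runs: \<open>v\<^sub>j\<close> orthogonal to the primal points with index \<open>\<le> j\<close>, and \<open>u\<^sub>j\<close> orthogonal to the dual points
  with index \<open>< j\<close>. The answers to the first \<open>j\<close> inquiries then do not depend on \<open>u\<^sub>j\<close>, \<open>v\<^sub>j\<close>, so
  \<open>A\<close> can be extended by one term without changing the run so far. After \<open>t\<close> steps the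
  primal output is orthogonal to \<open>v\<^sub>j\<close> for \<open>j \<ge> t\<close>, the dual output to \<open>u\<^sub>j\<close> for \<open>j > t\<close>. The gap is bounded
  below by the Lagrangian at two well-chosen test points; these are built from
  \<open>p\<^sub>k = u\<^sub>0 + \<dots> + u\<^sub>k\<close> and \<open>v\<^sub>0 + \<dots> + v\<^sub>k\<close>, for which \<open>A\<^sup>T p\<^sub>k = v\<^sub>k\<close> and
  \<open>A (v\<^sub>0 + \<dots> + v\<^sub>k) = u\<^sub>0 - u\<^sub>k\<^sub>+\<^sub>1\<close>.
\<close>

subsection \<open>Orthonormal families\<close>

definition orthonormal_upto :: "nat \<Rightarrow> (nat \<Rightarrow> 'a::real_inner) \<Rightarrow> bool" where
  "orthonormal_upto N u \<longleftrightarrow> (\<forall>i<N. \<forall>j<N. u i \<bullet> u j = of_bool (i = j))"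

lemma orthonormal_uptoD:
  "orthonormal_upto N u \<Longrightarrow> i < N \<Longrightarrow> j < N \<Longrightarrow> u i \<bullet> u j = of_bool (i = j)"
  by (simp add: orthonormal_upto_def)

lemma orthonormal_upto_mono: "orthonormal_upto N u \<Longrightarrow> K \<le> N \<Longrightarrow> orthonormal_upto K u"
  by (simp add: orthonormal_upto_def)

lemma orthonormal_upto_extend:
  assumes "orthonormal_upto N u" "norm w = 1" "\<And>i. i < N \<Longrightarrow> w \<bullet> u i = 0"
  shows "orthonormal_upto (Suc N) (u(N := w))"
  using assms by (auto simp: orthonormal_upto_def less_Suc_eq inner_commute norm_eq_1)

lemma inner_orthonormal_sum:
  assumes "orthonormal_upto N u" "j < N"
  shows "u j \<bullet> (\<Sum>i<N. c i *\<^sub>R u i) = c j"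
proof -
  have "u j \<bullet> (\<Sum>i<N. c i *\<^sub>R u i) = (\<Sum>i<N. if j = i then c i else 0)"
    unfolding inner_sum_right
    by (intro sum.cong refl) (use assms in \<open>auto simp: orthonormal_uptoD\<close>)
  then show ?thesis using assms(2) by simp
qed

lemma norm_orthonormal_sum:
  assumes "orthonormal_upto N u"
  shows "(norm (\<Sum>i<N. c i *\<^sub>R u i))\<^sup>2 = (\<Sum>i<N. (c i)\<^sup>2)"
proof -
  have "(\<Sum>i<N. c i *\<^sub>R u i) \<bullet> (\<Sum>i<N. c i *\<^sub>R u i) = (\<Sum>j<N. c j * (u j \<bullet> (\<Sum>i<N. c i *\<^sub>R u i)))"
    by (subst inner_sum_left) simp
  also have "\<dots> = (\<Sum>i<N. (c i)\<^sup>2)"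
    using assms by (intro sum.cong) (simp_all add: inner_orthonormal_sum power2_eq_square)
  finally show ?thesis by (simp add: power2_norm_eq_inner)
qed

lemma norm_sum_orthonormal:
  assumes "orthonormal_upto N u"
  shows "norm (\<Sum>i<N. u i) = sqrt N"
  using norm_orthonormal_sum[OF assms, of "\<lambda>_. 1"] by (simp add: real_sqrt_unique)

lemma bessel_inequality:
  assumes "orthonormal_upto N u"
  shows "(\<Sum>i<N. (u i \<bullet> x)\<^sup>2) \<le> (norm x)\<^sup>2"
proof -
  define s where "s = (\<Sum>i<N. (u i \<bullet> x) *\<^sub>R u i)"
  have s: "(norm s)\<^sup>2 = (\<Sum>i<N. (u i \<bullet> x)\<^sup>2)"
    unfolding s_def by (rule norm_orthonormal_sum[OF assms])
  have "s \<bullet> x = (\<Sum>i<N. (u i \<bullet> x)\<^sup>2)"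
    unfolding s_def by (simp add: inner_sum_left power2_eq_square)
  then have "(norm (x - s))\<^sup>2 = (norm x)\<^sup>2 - (norm s)\<^sup>2"
    unfolding s power2_norm_eq_inner
    by (simp add: inner_diff_left inner_diff_right inner_commute s[unfolded power2_norm_eq_inner])
  then show ?thesis using s by (metis diff_ge_0_iff_ge zero_le_power2)
qed

lemma ex_unit_orthogonal:
  fixes S :: "'a::euclidean_space set"
  assumes "finite S" "card S < DIM('a)"
  obtains w where "norm w = 1" "\<And>s. s \<in> S \<Longrightarrow> w \<bullet> s = 0"
proof -
  have "dim S < DIM('a)" using dim_le_card'[OF assms(1)] assms(2) by linarith
  then obtain z where z: "z \<noteq> 0" "\<And>y. y \<in> span S \<Longrightarrow> orthogonal z y"
    using orthogonal_to_subspace_exists by metis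
  show thesis
  proof (rule that[of "z /\<^sub>R norm z"])
    show "norm (z /\<^sub>R norm z) = 1" using z by simp
    show "(z /\<^sub>R norm z) \<bullet> s = 0" if "s \<in> S" for s
      using z(2)[OF span_base[OF that]] by (simp add: orthogonal_def)
  qed
qed

subsection \<open>Chain matrices\<close>

text \<open>The case \<open>0\<close> encodes the convention that the entry before the first one is
  zero, so partial sums telescope without a boundary term. The general type serves both the vectors
  \<open>v\<close> and their real coordinates.\<close>

definition bdiff :: "(nat \<Rightarrow> 'a::ab_group_add) \<Rightarrow> nat \<Rightarrow> 'a" where
  "bdiff a j = (case j of 0 \<Rightarrow> a 0 | Suc i \<Rightarrow> a (Suc i) - a i)"

lemma bdiff_simps [simp]: "bdiff a 0 = a 0" "bdiff a (Suc i) = a (Suc i) - a i"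
  by (simp_all add: bdiff_def)

lemma sum_bdiff: "(\<Sum>j<Suc k. bdiff a j) = a k"
  by (induction k) simp_all

lemma inner_bdiff: "bdiff v j \<bullet> x = bdiff (\<lambda>i. v i \<bullet> x) j"
  by (cases j) (simp_all add: inner_diff_left)

text \<open>Since (p - q)^2 is at most 2 p^2 + 2 q^2, each entry is charged at most twice with
  factor 2. The last entry is charged only once, hence the sharper bound that the induction
  carries.\<close>

lemma sum_bdiff_power2_le:
  fixes a :: "nat \<Rightarrow> real"
  shows "(\<Sum>j<N. (bdiff a j)\<^sup>2) \<le> 4 * (\<Sum>j<N. (a j)\<^sup>2)"
proof -
  have "(\<Sum>j<Suc k. (bdiff a j)\<^sup>2) \<le> 4 * (\<Sum>j<k. (a j)\<^sup>2) + 2 * (a k)\<^sup>2" for k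
  proof (induction k)
    case (Suc k)
    have "0 \<le> (a (Suc k) + a k)\<^sup>2" by simp
    then have "(bdiff a (Suc k))\<^sup>2 \<le> 2 * (a (Suc k))\<^sup>2 + 2 * (a k)\<^sup>2"
      by (simp add: power2_eq_square algebra_simps)
    then show ?case using Suc by simp
  qed simp
  then have "(\<Sum>j<Suc k. (bdiff a j)\<^sup>2) \<le> 4 * (\<Sum>j<Suc k. (a j)\<^sup>2)" for k
    by (rule order.trans) simp
  then show ?thesis by (cases N) auto
qed

text \<open>In the families \<open>u\<close> and \<open>v\<close> this is a bidiagonal matrix with 1
  on the diagonal and -1 below it. Raising \<open>N\<close> by one adds a single term, made of
  \<open>u N\<close>, \<open>v N\<close> and \<open>v (N - 1)\<close>.\<close>

definition chain_mat :: "(nat \<Rightarrow> real ^ 'm) \<Rightarrow> (nat \<Rightarrow> real ^ 'n) \<Rightarrow> nat \<Rightarrow> real ^ 'n ^ 'm" where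
  "chain_mat u v N = matrix (\<lambda>x. \<Sum>j<N. (bdiff v j \<bullet> x) *\<^sub>R u j)"

lemma chain_mat_mult: "chain_mat u v N *v x = (\<Sum>j<N. (bdiff v j \<bullet> x) *\<^sub>R u j)"
proof -
  have "linear (\<lambda>x. \<Sum>j<N. (bdiff v j \<bullet> x) *\<^sub>R u j)"
    by (rule linearI) (simp_all add: sum.distrib scaleR_sum_right inner_add_right scaleR_add_left)
  from fun_cong[OF matrix_vector_mul(2)[OF this], of x] show ?thesis
    unfolding chain_mat_def .
qed

lemma transpose_chain_mat_mult:
  "transpose (chain_mat u v N) *v y = (\<Sum>j<N. (u j \<bullet> y) *\<^sub>R bdiff v j)"
proof -
  have "(transpose (chain_mat u v N) *v y) \<bullet> x = (\<Sum>j<N. (u j \<bullet> y) *\<^sub>R bdiff v j) \<bullet> x" for x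
    unfolding transpose_matrix_vector dot_lmul_matrix chain_mat_mult inner_sum_left inner_sum_right
    by (intro sum.cong refl) (simp add: inner_commute)
  then show ?thesis using vector_eq_rdot by blast
qed

lemma chain_mat_cong:
  assumes "\<And>j. j < N \<Longrightarrow> u j = u' j" "\<And>j. j < N \<Longrightarrow> v j = v' j"
  shows "chain_mat u v N = chain_mat u' v' N"
proof -
  have "bdiff v j = bdiff v' j" if "j < N" for j
    using assms(2) that by (cases j) auto
  then show ?thesis using assms(1) unfolding chain_mat_def by simp
qed

text \<open>The coordinates of the image in \<open>u\<close> are backward differences of the
  coordinates \<open>v j \<bullet> x\<close>, so the difference estimate and Bessel's inequality
  give a bound free of \<open>N\<close>.\<close>

lemma spectral_norm_chain_mat_le:
  assumes "orthonormal_upto N u" "orthonormal_upto N v"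
  shows "spectral_norm (chain_mat u v N) \<le> 2"
  unfolding spectral_norm_def
proof (rule onorm_le)
  fix x
  have "(norm (chain_mat u v N *v x))\<^sup>2 = (\<Sum>j<N. (bdiff (\<lambda>i. v i \<bullet> x) j)\<^sup>2)"
    by (simp add: chain_mat_mult norm_orthonormal_sum[OF assms(1)] inner_bdiff)
  also have "\<dots> \<le> 4 * (\<Sum>j<N. (v j \<bullet> x)\<^sup>2)" by (rule sum_bdiff_power2_le)
  also have "\<dots> \<le> (2 * norm x)\<^sup>2"
    using bessel_inequality[OF assms(2), of x] by (simp add: power_mult_distrib)
  finally show "norm (chain_mat u v N *v x) \<le> 2 * norm x"
    by (rule power2_le_imp_le) simp
qed

lemma spectral_norm_nonneg: "0 \<le> spectral_norm A"
  unfolding spectral_norm_def by (intro onorm_pos_le) simp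

text \<open>Telescoping of the image coordinates along \<open>u 0\<close>, ..., \<open>u k\<close>.
  If \<open>x\<close> has no \<open>v k\<close> component, its image is thus orthogonal to this test
  vector.\<close>

lemma chain_mat_mult_inner_sum:
  assumes "orthonormal_upto N u" "k < N"
  shows "(chain_mat u v N *v x) \<bullet> (\<Sum>j<Suc k. u j) = v k \<bullet> x"
proof -
  have "(chain_mat u v N *v x) \<bullet> (\<Sum>j<Suc k. u j) = (\<Sum>j<Suc k. u j \<bullet> (chain_mat u v N *v x))"
    by (subst inner_commute) (rule inner_sum_left)
  also have "\<dots> = (\<Sum>j<Suc k. bdiff (\<lambda>i. v i \<bullet> x) j)"
    using assms by (intro sum.cong refl)
      (simp add: chain_mat_mult inner_orthonormal_sum inner_bdiff)
  finally show ?thesis by (simp only: sum_bdiff)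
qed

text \<open>The coordinates of the sum in \<open>v\<close> are 1 up to \<open>k\<close> and 0
  afterwards, a sequence that jumps up at 0 and down at \<open>Suc k\<close>. For
  \<open>k = N - 1\<close> the second jump lies outside the chain.\<close>

lemma chain_mat_mult_sum:
  assumes "orthonormal_upto N v" "k < N"
  shows "chain_mat u v N *v (\<Sum>j<Suc k. v j) = u 0 - (if Suc k < N then u (Suc k) else 0)"
proof -
  have v: "v i \<bullet> (\<Sum>j<Suc k. v j) = of_bool (i \<le> k)" if "i < N" for i
  proof -
    have "v i \<bullet> (\<Sum>j<Suc k. v j) = (\<Sum>j<Suc k. if i = j then 1 else 0)"
      unfolding inner_sum_right
      by (intro sum.cong refl) (use assms that in \<open>auto simp: orthonormal_uptoD\<close>)
    then show ?thesis by (simp add: less_Suc_eq_le)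
  qed
  have "bdiff v j \<bullet> (\<Sum>j<Suc k. v j) = of_bool (j = 0) - of_bool (j = Suc k)" if "j < N" for j
    using that unfolding inner_bdiff by (cases j) (auto simp: v simp del: sum.lessThan_Suc)
  then have "chain_mat u v N *v (\<Sum>j<Suc k. v j)
      = (\<Sum>j<N. (if j = 0 then u j else 0) - (if j = Suc k then u j else 0))"
    unfolding chain_mat_mult by (intro sum.cong refl) simp
  then show ?thesis using assms(2) by (simp add: sum_subtractf sum.delta)
qed

lemma chain_mat_nonzero:
  assumes "orthonormal_upto N u" "orthonormal_upto N v" "0 < N"
  shows "chain_mat u v N \<noteq> 0"
proof
  assume "chain_mat u v N = 0"
  then have "v 0 \<bullet> v 0 = 0"
    using chain_mat_mult_inner_sum[OF assms(1,3), of v "v 0"] by simp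
  then show False using orthonormal_uptoD[OF assms(2,3,3)] by simp
qed

subsection \<open>The resisting oracle\<close>

text \<open>The rules are deterministic, and the points with index \<open>s\<close> depend only on
  answers before \<open>s\<close>. Comparing both oracles along the run for \<open>A\<close> is
  enough: by induction the run for \<open>A'\<close> asks the same questions.\<close>

lemma run_cong:
  assumes "\<And>k. k < s \<Longrightarrow>
    oracle_answer f A' (inquiry M \<theta> f A k) = oracle_answer f A (inquiry M \<theta> f A k)"
  shows "inquiry M \<theta> f A' s = inquiry M \<theta> f A s \<and> approx_sol M \<theta> f A' s = approx_sol M \<theta> f A s"
  using assms
proof (induction s rule: less_induct)
  case (less s)
  have "oracle_answer f A' (inquiry M \<theta> f A' k) = oracle_answer f A (inquiry M \<theta> f A k)"
    if "k < s" for k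
    using less.IH[OF that] less.prems that by simp
  then have "answers M \<theta> f A' k = answers M \<theta> f A k" if "k < s" for k
    using that by (simp add: answers_eq_map_inquiry del: upt_Suc)
  then show ?case by (cases s) auto
qed

text \<open>\<open>T\<close> keeps the set of points to avoid finite. The strict
  \<open>k < j\<close> for \<open>u\<close> leaves no condition at \<open>j = 0\<close>, because
  \<open>u 0\<close> is fixed in advance as the direction of the known vector
  \<open>b\<close>.\<close>

definition resists ::
    "('n::finite, 'm::finite) fo_method \<Rightarrow> ('n, 'm) known_data \<Rightarrow> (real ^ 'n \<Rightarrow> real) \<Rightarrow> nat
      \<Rightarrow> (nat \<Rightarrow> real ^ 'm) \<Rightarrow> (nat \<Rightarrow> real ^ 'n) \<Rightarrow> nat \<Rightarrow> bool" where
  "resists M \<theta> f T u v N \<longleftrightarrow> (\<forall>j<N. \<forall>k\<le>T.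
     (k \<le> j \<longrightarrow> v j \<bullet> fst (inquiry M \<theta> f (chain_mat u v N) k) = 0 \<and>
                v j \<bullet> fst (approx_sol M \<theta> f (chain_mat u v N) k) = 0) \<and>
     (k < j \<longrightarrow> u j \<bullet> snd (inquiry M \<theta> f (chain_mat u v N) k) = 0 \<and>
                u j \<bullet> snd (approx_sol M \<theta> f (chain_mat u v N) k) = 0))"

lemma resistsD:
  assumes "resists M \<theta> f T u v N" "j < N" "k \<le> T"
  shows "k \<le> j \<Longrightarrow> v j \<bullet> fst (inquiry M \<theta> f (chain_mat u v N) k) = 0"
    and "k \<le> j \<Longrightarrow> v j \<bullet> fst (approx_sol M \<theta> f (chain_mat u v N) k) = 0"
    and "k < j \<Longrightarrow> u j \<bullet> snd (inquiry M \<theta> f (chain_mat u v N) k) = 0"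
    and "k < j \<Longrightarrow> u j \<bullet> snd (approx_sol M \<theta> f (chain_mat u v N) k) = 0"
  using assms unfolding resists_def by blast+

text \<open>An inquiry with index \<open>k < s \<le> N\<close> is orthogonal to \<open>v N\<close>
  and \<open>u N\<close> by assumption and to \<open>v (N - 1)\<close> by resistance, so the added
  term does not alter its answer.\<close>

lemma resists_run_eq:
  assumes "resists M \<theta> f T u v N" "s \<le> N" "s \<le> T"
    and "\<And>k. k \<le> T \<Longrightarrow> v N \<bullet> fst (inquiry M \<theta> f (chain_mat u v N) k) = 0"
    and "\<And>k. k \<le> T \<Longrightarrow> k < N \<Longrightarrow> u N \<bullet> snd (inquiry M \<theta> f (chain_mat u v N) k) = 0"
  shows "inquiry M \<theta> f (chain_mat u v (Suc N)) s = inquiry M \<theta> f (chain_mat u v N) s \<and>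
         approx_sol M \<theta> f (chain_mat u v (Suc N)) s = approx_sol M \<theta> f (chain_mat u v N) s"
proof (rule run_cong)
  fix k assume k: "k < s"
  obtain x y where q: "inquiry M \<theta> f (chain_mat u v N) k = (x, y)" by fastforce
  obtain N' where N: "N = Suc N'" using k assms(2) by (cases N) auto
  have "v N \<bullet> x = 0" "u N \<bullet> y = 0"
    using assms(4,5)[of k] k assms(2,3) q by auto
  moreover have "v N' \<bullet> x = 0"
    using resistsD(1)[OF assms(1), of N' k] k assms(2,3) q N by simp
  ultimately have "bdiff v N \<bullet> x = 0" "u N \<bullet> y = 0" by (simp_all add: N inner_diff_left)
  then have "chain_mat u v (Suc N) *v x = chain_mat u v N *v x"
    "transpose (chain_mat u v (Suc N)) *v y = transpose (chain_mat u v N) *v y"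
    by (simp_all only: chain_mat_mult transpose_chain_mat_mult) simp_all
  then show "oracle_answer f (chain_mat u v (Suc N)) (inquiry M \<theta> f (chain_mat u v N) k) =
      oracle_answer f (chain_mat u v N) (inquiry M \<theta> f (chain_mat u v N) k)"
    by (simp add: q oracle_answer_def)
qed

text \<open>Each new pair is chosen orthogonal to the chain so far and to all inquiry and output
  points of index up to \<open>T\<close> in the current run. On each side these are at most
  \<open>N + 2 * T + 2\<close> vectors, so one further dimension leaves room.\<close>

lemma resisting_chain_exists:
  fixes M :: "('n::finite, 'm::finite) fo_method" and e :: "real ^ 'm"
  assumes "norm e = 1" "N + 2 * T + 2 \<le> CARD('m)" "N + 2 * T + 2 \<le> CARD('n)"
  shows "\<exists>u v. orthonormal_upto N u \<and> orthonormal_upto N v \<and> (0 < N \<longrightarrow> u 0 = e) \<and>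
           resists M \<theta> f T u v N"
  using assms(2,3)
proof (induction N)
  case 0
  then show ?case by (auto simp: orthonormal_upto_def resists_def)
next
  case (Suc N)
  then obtain u v where u: "orthonormal_upto N u" and v: "orthonormal_upto N v"
    and e: "0 < N \<Longrightarrow> u 0 = e" and res: "resists M \<theta> f T u v N" by auto
  define q where "q = inquiry M \<theta> f (chain_mat u v N)"
  define r where "r = approx_sol M \<theta> f (chain_mat u v N)"
  have card_le: "card (w ` {..<N} \<union> (h \<circ> q) ` {..T} \<union> (h \<circ> r) ` {..T}) \<le> N + 2 * T + 2"
    for w :: "nat \<Rightarrow> 'z" and h
    using card_Un_le[of "w ` {..<N} \<union> (h \<circ> q) ` {..T}" "(h \<circ> r) ` {..T}"]
      card_Un_le[of "w ` {..<N}" "(h \<circ> q) ` {..T}"] card_image_le[of "{..<N}" w]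
      card_image_le[of "{..T}" "h \<circ> q"] card_image_le[of "{..T}" "h \<circ> r"]
    by simp
  obtain b where b: "norm b = 1"
    "\<And>s. s \<in> v ` {..<N} \<union> (fst \<circ> q) ` {..T} \<union> (fst \<circ> r) ` {..T} \<Longrightarrow> b \<bullet> s = 0"
    by (rule ex_unit_orthogonal[of "v ` {..<N} \<union> (fst \<circ> q) ` {..T} \<union> (fst \<circ> r) ` {..T}"])
       (use card_le[of v fst] Suc.prems in simp_all)
  obtain a' where a': "norm a' = 1"
    "\<And>s. s \<in> u ` {..<N} \<union> (snd \<circ> q) ` {..T} \<union> (snd \<circ> r) ` {..T} \<Longrightarrow> a' \<bullet> s = 0"
    by (rule ex_unit_orthogonal[of "u ` {..<N} \<union> (snd \<circ> q) ` {..T} \<union> (snd \<circ> r) ` {..T}"])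
       (use card_le[of u snd] Suc.prems in simp_all)
  define a where "a = (if N = 0 then e else a')"
  define u' where "u' = u(N := a)"
  define v' where "v' = v(N := b)"
  have B: "chain_mat u' v' N = chain_mat u v N"
    unfolding u'_def v'_def by (rule chain_mat_cong) auto
  have u': "orthonormal_upto (Suc N) u'"
    unfolding u'_def by (rule orthonormal_upto_extend[OF u]) (use a' assms(1) in \<open>auto simp: a_def\<close>)
  have v': "orthonormal_upto (Suc N) v'"
    unfolding v'_def by (rule orthonormal_upto_extend[OF v]) (use b in auto)
  have res': "resists M \<theta> f T u' v' N"
    using res B unfolding resists_def by (auto simp: u'_def v'_def)
  have newv: "v' N \<bullet> fst (q k) = 0" "v' N \<bullet> fst (r k) = 0" if "k \<le> T" for k
    using b(2) that by (auto simp: v'_def)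
  have newu: "u' N \<bullet> snd (q k) = 0" "u' N \<bullet> snd (r k) = 0" if "k \<le> T" "k < N" for k
    using a'(2) that by (auto simp: u'_def a_def)
  \<comment> \<open>Points with index above \<open>N\<close> may change with the new term, but the
    conditions for \<open>j \<le> N\<close> do not concern them.\<close>
  have run: "inquiry M \<theta> f (chain_mat u' v' (Suc N)) k = q k \<and>
      approx_sol M \<theta> f (chain_mat u' v' (Suc N)) k = r k" if "k \<le> T" "k \<le> N" for k
    using resists_run_eq[OF res' that(2,1)] newu newv unfolding B q_def r_def by blast
  have "resists M \<theta> f T u' v' (Suc N)"
    unfolding resists_def
  proof (intro allI impI)
    fix j k assume j: "j < Suc N" and k: "k \<le> T"
    show "(k \<le> j \<longrightarrow> v' j \<bullet> fst (inquiry M \<theta> f (chain_mat u' v' (Suc N)) k) = 0 \<and>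
                v' j \<bullet> fst (approx_sol M \<theta> f (chain_mat u' v' (Suc N)) k) = 0) \<and>
      (k < j \<longrightarrow> u' j \<bullet> snd (inquiry M \<theta> f (chain_mat u' v' (Suc N)) k) = 0 \<and>
                u' j \<bullet> snd (approx_sol M \<theta> f (chain_mat u' v' (Suc N)) k) = 0)"
    proof (cases "j = N")
      case True
      then show ?thesis using run[OF k] newv[OF k] newu[OF k] by auto
    next
      case False
      then have "j < N" using j by simp
      then show ?thesis
        using run[OF k] resistsD[OF res' _ k, unfolded B, folded q_def r_def] by auto
    qed
  qed
  moreover have "u' 0 = e" using e by (auto simp: u'_def a_def)
  ultimately show ?case using u' v' by blast
qed

subsection \<open>Quadratic instances\<close>

definition lagrangian ::
    "('n::finite, 'm::finite) known_data \<Rightarrow> (real ^ 'n \<Rightarrow> real) \<Rightarrow> real ^ 'n ^ 'm \<Rightarrow> real ^ 'n \<Rightarrow> real ^ 'm \<Rightarrow> real" where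
  "lagrangian \<theta> f A x y = f x + (A *v x - bvec \<theta>) \<bullet> y - gfun \<theta> y"

text \<open>The supremum is bounded below by its value at \<open>y\<close>, the infimum above by its
  value at \<open>x\<close>. Compactness and continuity make both ranges bounded, without which
  \<open>SUP\<close> and \<open>INF\<close> on the reals carry no information.\<close>

lemma gap_at_ge_lagrangian_diff:
  assumes "compact (Xset \<theta>)" "compact (Yset \<theta>)"
    and "continuous_on (Xset \<theta>) f" "continuous_on (Yset \<theta>) (gfun \<theta>)"
    and "x \<in> Xset \<theta>" "y \<in> Yset \<theta>"
  shows "gap_at M \<theta> f A t \<ge> lagrangian \<theta> f A (fst (approx_sol M \<theta> f A t)) y
           - lagrangian \<theta> f A x (snd (approx_sol M \<theta> f A t))"
proof -
  obtain xb yb where s: "approx_sol M \<theta> f A t = (xb, yb)" by fastforce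
  have "compact ((\<lambda>y. (A *v xb - bvec \<theta>) \<bullet> y - gfun \<theta> y) ` Yset \<theta>)"
    by (intro compact_continuous_image continuous_intros assms)
  then have "(A *v xb - bvec \<theta>) \<bullet> y - gfun \<theta> y
      \<le> (SUP y\<in>Yset \<theta>. (A *v xb - bvec \<theta>) \<bullet> y - gfun \<theta> y)"
    using assms(6) by (intro cSUP_upper bounded_imp_bdd_above compact_imp_bounded)
  moreover have "compact ((\<lambda>x. (A *v x - bvec \<theta>) \<bullet> yb + f x) ` Xset \<theta>)"
    by (intro compact_continuous_image continuous_intros assms
        linear_continuous_on linear_conv_bounded_linear[THEN iffD1]) simp
  then have "(INF x\<in>Xset \<theta>. (A *v x - bvec \<theta>) \<bullet> yb + f x) \<le> (A *v x - bvec \<theta>) \<bullet> yb + f x"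
    using assms(5) by (intro cINF_lower bounded_imp_bdd_below compact_imp_bounded)
  ultimately show ?thesis
    by (simp add: gap_at_def s primal_obj_def dual_obj_def lagrangian_def)
qed

definition quad :: "real \<Rightarrow> 'a::real_inner \<Rightarrow> real" where
  "quad c x = c / 2 * (x \<bullet> x)"

lemma GDERIV_quad: "GDERIV (quad c) x :> c *\<^sub>R x"
  unfolding gderiv_def quad_def
  by (auto intro!: derivative_eq_intros simp: inner_commute algebra_simps)

lemma gradient_quad: "gradient (quad c) = (\<lambda>x. c *\<^sub>R x)"
  by (rule ext) (rule gradient_eqI[OF GDERIV_quad])

lemma strongly_convex_quad: "strongly_convex c (quad c)"
  by (simp add: strongly_convex_def gradient_quad power2_norm_eq_inner scaleR_diff_right[symmetric])

text \<open>\<open>L\<close> may exceed \<open>c\<close>: the first instance pairs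
  \<open>c = 0\<close> with a prescribed positive \<open>L\<close>.\<close>

lemma lipschitz_gradient_quad:
  assumes "0 \<le> c" "c \<le> L"
  shows "L-lipschitz_on UNIV (gradient (quad c :: 'a::real_inner \<Rightarrow> real))"
  using assms
  by (intro lipschitz_onI)
     (auto simp: gradient_quad dist_norm scaleR_diff_right[symmetric] intro!: mult_right_mono)

lemma continuous_on_quad: "continuous_on S (quad c)"
  unfolding quad_def by (intro continuous_intros)

lemma closed_convex_fun_quad:
  assumes "0 \<le> c"
  shows "closed_convex_fun (quad c :: 'a::real_inner \<Rightarrow> real)"
proof -
  have "convex_on UNIV (quad c :: 'a \<Rightarrow> real)"
  proof (intro convex_onI)
    fix s :: real and x y :: 'a
    assume s: "0 < s" "s < 1"
    have "(1 - s) * quad c x + s * quad c y - quad c ((1 - s) *\<^sub>R x + s *\<^sub>R y)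
        = s * (1 - s) * (c / 2 * ((x - y) \<bullet> (x - y)))"
      by (simp add: quad_def inner_add_left inner_add_right inner_diff_left inner_diff_right
          inner_commute field_simps)
    also have "\<dots> \<ge> 0" using s assms by simp
    finally show "quad c ((1 - s) *\<^sub>R x + s *\<^sub>R y) \<le> (1 - s) * quad c x + s * quad c y" by simp
  qed simp
  moreover have "closed {p :: 'a \<times> real. quad c (fst p) \<le> snd p}"
    by (intro closed_Collect_le continuous_intros continuous_on_compose2[OF continuous_on_quad[of UNIV]])
       auto
  ultimately show ?thesis by (simp add: closed_convex_fun_def epigraph_def)
qed

definition ball_data :: "real \<Rightarrow> real \<Rightarrow> real ^ 'm \<Rightarrow> real \<Rightarrow> ('n::finite, 'm::finite) known_data" where
  "ball_data RX RY b L =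
     \<lparr>Xset = cball 0 RX, Yset = cball 0 RY, gfun = (\<lambda>_. 0), bvec = b, Lconst = L\<rparr>"

lemma ball_data_sel [simp]:
  "Xset (ball_data RX RY b L) = cball 0 RX" "Yset (ball_data RX RY b L) = cball 0 RY"
  "gfun (ball_data RX RY b L) = (\<lambda>_. 0)" "bvec (ball_data RX RY b L) = b"
  "Lconst (ball_data RX RY b L) = L"
  by (simp_all add: ball_data_def)

lemma bilinear_spp_ball_data:
  fixes A :: "real ^ 'n ^ 'm"
  assumes "0 \<le> c" "c \<le> L" "0 \<le> RX" "0 \<le> RY"
  shows "bilinear_spp (ball_data RX RY b L) (quad c) A"
proof -
  have "closed_convex_fun (\<lambda>_ :: real ^ 'm. 0)"
    using closed_convex_fun_quad[of 0] by (simp add: quad_def[abs_def])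
  moreover have "quad c differentiable at x" for x :: "real ^ 'n"
    using GDERIV_quad[of c x] unfolding gderiv_def differentiable_def by blast
  ultimately show ?thesis
    using assms by (simp add: bilinear_spp_def closed_convex_fun_quad lipschitz_gradient_quad)
qed

lemma gap_at_ball_data_ge:
  assumes "norm x \<le> RX" "norm y \<le> RY"
  shows "gap_at M (ball_data RX RY b L) (quad c) A t \<ge>
     lagrangian (ball_data RX RY b L) (quad c) A (fst (approx_sol M (ball_data RX RY b L) (quad c) A t)) y
   - lagrangian (ball_data RX RY b L) (quad c) A x (snd (approx_sol M (ball_data RX RY b L) (quad c) A t))"
  using assms by (intro gap_at_ge_lagrangian_diff) (auto intro: continuous_on_quad)

subsection \<open>The two lower bounds\<close>

text \<open>The image of the primal output is orthogonal to the test point \<open>y\<close>, so only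
  the term in \<open>b\<close> is left there; the test point \<open>x\<close> solves
  \<open>A x = b\<close>, so the Lagrangian vanishes there. The dimension \<open>4 * t + 4\<close>
  is \<open>N + 2 * t + 2\<close> for \<open>N = 2 * t + 2\<close>.\<close>

lemma convex_case:
  fixes M :: "('n::finite, 'm::finite) fo_method"
  assumes "4 * t + 4 \<le> CARD('m)" "4 * t + 4 \<le> CARD('n)" "0 < L"
  shows "\<exists>\<theta> (f :: real ^ 'n \<Rightarrow> real) (A :: real ^ 'n ^ 'm) RX RY.
        bilinear_spp \<theta> f A \<and> Lconst \<theta> = L \<and> A \<noteq> 0 \<and>
        is_ball (Xset \<theta>) RX \<and> is_ball (Yset \<theta>) RY \<and>
        gap_at M \<theta> f A t \<ge>
          L * RX\<^sup>2 / (16 * (4 * real t + 9)\<^sup>2)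
          + ((sqrt 2 + 2) / 4) * (spectral_norm A * RX * RY / (4 * real t + 9))"
proof -
  define N where "N = 2 * t + 2"
  define e :: "real ^ 'm" where "e = axis undefined 1"
  have e: "norm e = 1" by (simp add: e_def norm_axis_1)
  \<comment> \<open>The largest factor that keeps \<open>x\<close> in the unit ball, as the sum of
    all \<open>v j\<close> has norm \<open>sqrt N\<close>.\<close>
  define \<beta> where "\<beta> = 1 / sqrt N"
  have \<beta>: "0 < \<beta>" by (simp add: \<beta>_def N_def)
  \<comment> \<open>With radii 1 and \<open>L\<close> both terms of the bound are proportional to
    \<open>L\<close>, which then cancels.\<close>
  define \<theta> :: "('n, 'm) known_data" where "\<theta> = ball_data 1 L (\<beta> *\<^sub>R e) L"
  define f :: "real ^ 'n \<Rightarrow> real" where "f = quad 0"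
  obtain u v where u: "orthonormal_upto N u" and v: "orthonormal_upto N v" and u0: "u 0 = e"
    and res: "resists M \<theta> f t u v N"
    using resisting_chain_exists[OF e, of N t M \<theta> f] assms(1,2) by (auto simp: N_def)
  define A where "A = chain_mat u v N"
  obtain xb yb where s: "approx_sol M \<theta> f A t = (xb, yb)" by fastforce
  have t: "t < N" "Suc t \<le> N" by (simp_all add: N_def)
  have vx: "v t \<bullet> xb = 0"
    using resistsD(2)[OF res t(1), of t] s by (simp add: A_def)
  define y where "y = - (L / sqrt (Suc t)) *\<^sub>R (\<Sum>j<Suc t. u j)"
  define x where "x = \<beta> *\<^sub>R (\<Sum>j<N. v j)"
  have ny: "norm y \<le> L"
    unfolding y_def norm_scaleR norm_sum_orthonormal[OF orthonormal_upto_mono[OF u t(2)]]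
    using assms(3) by simp
  have nx: "norm x \<le> 1"
    unfolding x_def norm_scaleR norm_sum_orthonormal[OF v] using \<beta> by (simp add: \<beta>_def)
  have "u 0 \<bullet> (\<Sum>j<Suc t. u j) = 1"
    using inner_orthonormal_sum[OF orthonormal_upto_mono[OF u t(2)], of 0 "\<lambda>_. 1"] by simp
  then have "lagrangian \<theta> f A xb y = L * \<beta> / sqrt (Suc t)"
    using chain_mat_mult_inner_sum[OF u t(1), of v xb] vx
    by (simp add: lagrangian_def \<theta>_def f_def quad_def A_def y_def inner_diff_left u0
        del: sum.lessThan_Suc)
  \<comment> \<open>The sum runs over the whole chain, so only the jump at 0 remains.\<close>
  moreover have "A *v (\<Sum>j<N. v j) = e"
    using chain_mat_mult_sum[OF v, of "2 * t + 1" u] by (simp add: A_def u0 N_def)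
  then have "lagrangian \<theta> f A x yb = 0"
    by (simp add: lagrangian_def \<theta>_def f_def quad_def x_def matrix_vector_mult_scaleR)
  ultimately have gap: "gap_at M \<theta> f A t \<ge> L * \<beta> / sqrt (Suc t)"
    using gap_at_ball_data_ge[OF nx ny,
        where M = M and b = "\<beta> *\<^sub>R e" and L = L and c = 0 and A = A and t = t]
    unfolding \<theta>_def[symmetric] f_def[symmetric] s by simp
  define d where "d = 4 * real t + 9"
  have d: "9 \<le> d" by (simp add: d_def)
  \<comment> \<open>The claimed bound divided by \<open>L\<close> is at most 2.725 /
    \<open>d\<close>, from (1.45 + 2) / 4 = 0.8625, spectral norm at most 2, and 1 /
    \<open>d\<close> for the first term. The gap divided by \<open>L\<close> is at least 4 / (1.45
    \<open>d\<close>), which exceeds 2.75 / \<open>d\<close>.\<close>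
  have sq2: "1.4 < sqrt 2" "sqrt 2 < 1.45"
    by (rule real_less_rsqrt real_less_lsqrt; simp add: power2_eq_square)+
  have "sqrt N * sqrt (Suc t) = sqrt 2 * (real t + 1)"
  proof -
    have "real N * real (Suc t) = 2 * (real t + 1)\<^sup>2"
      by (simp add: N_def power2_eq_square algebra_simps)
    then show ?thesis by (simp only: real_sqrt_mult[symmetric]) (simp add: real_sqrt_mult)
  qed
  moreover have "sqrt 2 * (real t + 1) \<le> 1.45 * (d / 4)"
    using sq2 by (intro mult_mono) (simp_all add: d_def)
  moreover have "0 < sqrt N * sqrt (Suc t)" by (simp add: N_def)
  ultimately have "1 / (1.45 * (d / 4)) \<le> 1 / (sqrt N * sqrt (Suc t))"
    by (intro frac_le) auto
  then have main: "2.75 / d \<le> \<beta> / sqrt (Suc t)"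
    using d by (simp add: \<beta>_def field_simps)
  have "((sqrt 2 + 2) / 4) * (spectral_norm A / d) \<le> 0.8625 * (2 / d)"
    using sq2 d spectral_norm_chain_mat_le[OF u v] spectral_norm_nonneg[of A]
    by (intro mult_mono divide_right_mono) (auto simp: A_def)
  moreover have "1 / (16 * d\<^sup>2) \<le> 1 / d"
    using d by (simp add: field_simps power2_eq_square)
  moreover have "0.8625 * (2 / d) + 1 / d \<le> 2.75 / d"
    using d by (simp add: field_simps)
  ultimately have "1 / (16 * d\<^sup>2) + ((sqrt 2 + 2) / 4) * (spectral_norm A / d) \<le> \<beta> / sqrt (Suc t)"
    using main by linarith
  from mult_left_mono[OF this, of L]
  have "L * 1\<^sup>2 / (16 * (4 * real t + 9)\<^sup>2)
      + ((sqrt 2 + 2) / 4) * (spectral_norm A * 1 * L / (4 * real t + 9)) \<le> L * \<beta> / sqrt (Suc t)"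
    using assms(3) unfolding d_def[symmetric] by (simp add: algebra_simps)
  then have "gap_at M \<theta> f A t \<ge> L * 1\<^sup>2 / (16 * (4 * real t + 9)\<^sup>2)
      + ((sqrt 2 + 2) / 4) * (spectral_norm A * 1 * L / (4 * real t + 9))"
    using gap by linarith
  moreover have "A \<noteq> 0" unfolding A_def by (rule chain_mat_nonzero[OF u v]) (simp add: N_def)
  moreover have "bilinear_spp \<theta> f A"
    unfolding \<theta>_def f_def using assms(3) by (intro bilinear_spp_ball_data) auto
  moreover have "is_ball (Xset \<theta>) 1" "is_ball (Yset \<theta>) L" "Lconst \<theta> = L"
    using assms(3) by (auto simp: is_ball_def \<theta>_def)
  ultimately show ?thesis by blast
qed

text \<open>At \<open>y\<close> the Lagrangian is at least N / (2 \<mu>) by completing the square;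
  at \<open>x\<close> it is (t + 1) / (2 \<mu>), because the dual output does not see where the sum
  \<open>w\<close> stops. Taking \<open>N\<close> twice \<open>t + 1\<close> leaves a gap of (t + 1)
  / (2 \<mu>).\<close>

lemma strongly_convex_case:
  fixes M :: "('n::finite, 'm::finite) fo_method"
  assumes "4 * t + 4 \<le> CARD('m)" "4 * t + 4 \<le> CARD('n)" "0 < \<mu>"
  shows "\<exists>\<theta> (f :: real ^ 'n \<Rightarrow> real) (A :: real ^ 'n ^ 'm) RX RY.
        bilinear_spp \<theta> f A \<and> strongly_convex \<mu> f \<and> A \<noteq> 0 \<and>
        is_ball (Xset \<theta>) RX \<and> is_ball (Yset \<theta>) RY \<and>
        gap_at M \<theta> f A t \<ge>
          5 * (spectral_norm A)\<^sup>2 * RY\<^sup>2 / (512 * \<mu> * (4 * real t + 9)\<^sup>2)"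
proof -
  define N where "N = 2 * t + 2"
  define e :: "real ^ 'm" where "e = axis undefined 1"
  have e: "norm e = 1" by (simp add: e_def norm_axis_1)
  \<comment> \<open>\<open>RX\<close> is the norm of \<open>x\<close>; \<open>RY\<close> bounds
    \<open>y\<close>, a sum of \<open>N\<close> vectors of norm at most
    \<open>sqrt N\<close>.\<close>
  define RX where "RX = sqrt (Suc t) / \<mu>"
  define RY where "RY = real N * sqrt N"
  have R: "0 < RX" "0 < RY" using assms(3) by (simp_all add: RX_def RY_def N_def)
  define \<theta> :: "('n, 'm) known_data" where "\<theta> = ball_data RX RY (- (1 / \<mu>) *\<^sub>R e) \<mu>"
  define f :: "real ^ 'n \<Rightarrow> real" where "f = quad \<mu>"
  obtain u v where u: "orthonormal_upto N u" and v: "orthonormal_upto N v" and u0: "u 0 = e"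
    and res: "resists M \<theta> f t u v N"
    using resisting_chain_exists[OF e, of N t M \<theta> f] assms(1,2) by (auto simp: N_def)
  define A where "A = chain_mat u v N"
  obtain xb yb where s: "approx_sol M \<theta> f A t = (xb, yb)" by fastforce
  have t: "t < N" "Suc t \<le> N" "Suc t < N" by (simp_all add: N_def)
  \<comment> \<open>The dual output is orthogonal to \<open>u j\<close> only for
    \<open>j > t\<close>, hence the index \<open>Suc t\<close>, at which \<open>A w\<close>
    ends.\<close>
  have uy: "u (Suc t) \<bullet> yb = 0"
    using resistsD(4)[OF res t(3), of t] s by (simp add: A_def)
  \<comment> \<open>Adding up all partial sums gives A^T \<open>y\<close> =
    \<open>z\<close>.\<close>
  define y where "y = (\<Sum>k<N. \<Sum>j<Suc k. u j)"
  define z where "z = (\<Sum>k<N. v k)"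
  define w where "w = (\<Sum>j<Suc t. v j)"
  define x where "x = - (1 / \<mu>) *\<^sub>R w"
  have "norm y \<le> (\<Sum>k<N. norm (\<Sum>j<Suc k. u j))"
    unfolding y_def by (rule norm_sum)
  also have "\<dots> \<le> (\<Sum>k<N. sqrt N)"
  proof (rule sum_mono)
    fix k assume "k \<in> {..<N}"
    then have "Suc k \<le> N" by simp
    then show "norm (\<Sum>j<Suc k. u j) \<le> sqrt N"
      unfolding norm_sum_orthonormal[OF orthonormal_upto_mono[OF u \<open>Suc k \<le> N\<close>]] by simp
  qed
  finally have ny: "norm y \<le> RY" by (simp add: RY_def)
  have nw: "norm w = sqrt (Suc t)"
    unfolding w_def by (rule norm_sum_orthonormal[OF orthonormal_upto_mono[OF v t(2)]])
  then have nx: "norm x \<le> RX" using assms(3) by (simp add: x_def RX_def)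
  have zz: "z \<bullet> z = N"
    using norm_sum_orthonormal[OF v] by (simp add: z_def norm_eq_sqrt_inner)
  have ww: "w \<bullet> w = 1 + real t"
    using nw by (simp add: norm_eq_sqrt_inner)
  have "u 0 \<bullet> (\<Sum>j<Suc k. u j) = 1" if "k < N" for k
    using inner_orthonormal_sum[OF orthonormal_upto_mono[OF u], of "Suc k" 0 "\<lambda>_. 1"] that by simp
  then have ey: "e \<bullet> y = N"
    unfolding y_def inner_sum_right[of _ _ "{..<N}"] u0[symmetric]
    by (simp del: sum.lessThan_Suc)
  have Ay: "(A *v xb) \<bullet> y = z \<bullet> xb"
    unfolding y_def z_def A_def inner_sum_right[of _ _ "{..<N}"] inner_sum_left[of _ "{..<N}"]
    using chain_mat_mult_inner_sum[OF u, of _ v xb] by (simp del: sum.lessThan_Suc)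
  have "A *v w = e - u (Suc t)"
    using chain_mat_mult_sum[OF v t(1), of u] t(3) unfolding w_def A_def by (simp add: u0)
  \<comment> \<open>Paired with \<open>yb\<close>, the vectors \<open>A x\<close> and
    \<open>b\<close> agree, so the bilinear term at \<open>x\<close> vanishes.\<close>
  then have Aw: "(A *v w) \<bullet> yb = e \<bullet> yb" using uy by (simp add: inner_diff_left)
  \<comment> \<open>Quadratic part plus \<open>z \<bullet> xb\<close> is at least -N / (2 \<mu>),
    while \<open>- b \<bullet> y\<close> contributes N / \<mu>.\<close>
  have "0 \<le> \<mu> / 2 * ((xb + (1 / \<mu>) *\<^sub>R z) \<bullet> (xb + (1 / \<mu>) *\<^sub>R z))"
    using assms(3) by simp
  also have "\<dots> = \<mu> / 2 * (xb \<bullet> xb) + z \<bullet> xb + N / (2 * \<mu>)"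
    using assms(3)
    by (simp add: inner_add_left inner_add_right inner_commute[of xb z] zz field_simps power2_eq_square)
  finally have "N / (2 * \<mu>) \<le> lagrangian \<theta> f A xb y"
    by (simp add: lagrangian_def \<theta>_def f_def quad_def inner_add_left Ay ey)
  moreover have "lagrangian \<theta> f A x yb = (1 + real t) / (2 * \<mu>)"
    using assms(3)
    by (simp add: lagrangian_def \<theta>_def f_def quad_def x_def inner_add_left inner_diff_left
        matrix_vector_mult_scaleR Aw ww linear_neg[OF matrix_vector_mul_linear] field_simps)
  moreover have "gap_at M \<theta> f A t \<ge> lagrangian \<theta> f A xb y - lagrangian \<theta> f A x yb"
    using gap_at_ball_data_ge[OF nx ny,
        where M = M and b = "- (1 / \<mu>) *\<^sub>R e" and L = \<mu> and c = \<mu> and A = A and t = t]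
    unfolding \<theta>_def[symmetric] f_def[symmetric] s by simp
  ultimately have "gap_at M \<theta> f A t \<ge> N / (2 * \<mu>) - (1 + real t) / (2 * \<mu>)" by linarith
  moreover have "N / (2 * \<mu>) - (1 + real t) / (2 * \<mu>) = (1 + real t) / (2 * \<mu>)"
    using assms(3) by (simp add: N_def field_simps)
  ultimately have gap: "gap_at M \<theta> f A t \<ge> (1 + real t) / (2 * \<mu>)" by linarith
  have "(spectral_norm A)\<^sup>2 \<le> 2\<^sup>2"
    using spectral_norm_chain_mat_le[OF u v] spectral_norm_nonneg[of A]
    by (intro power_mono) (auto simp: A_def)
  moreover have RY2: "RY\<^sup>2 = 8 * (1 + real t) ^ 3"
    by (simp add: RY_def N_def power_mult_distrib power2_eq_square power3_eq_cube algebra_simps)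
  ultimately have "5 * (spectral_norm A)\<^sup>2 * RY\<^sup>2 \<le> 5 * 2\<^sup>2 * (8 * (1 + real t) ^ 3)"
    by (intro mult_mono) auto
  \<comment> \<open>4096 is 256 * 4^2, chosen so that 256 / 512 yields the factor 1/2 of the
    gap.\<close>
  also have "\<dots> \<le> 4096 * (1 + real t) ^ 3" by simp
  also have "\<dots> = 256 * (1 + real t) * (4 * (1 + real t))\<^sup>2"
    by (simp only: power_mult_distrib) (simp add: power2_eq_square power3_eq_cube algebra_simps)
  also have "\<dots> \<le> 256 * (1 + real t) * (4 * real t + 9)\<^sup>2"
    by (intro mult_left_mono power_mono) auto
  finally have "5 * (spectral_norm A)\<^sup>2 * RY\<^sup>2 / (512 * \<mu> * (4 * real t + 9)\<^sup>2)
      \<le> 256 * (1 + real t) * (4 * real t + 9)\<^sup>2 / (512 * \<mu> * (4 * real t + 9)\<^sup>2)"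
    using assms(3) by (intro divide_right_mono) auto
  also have "\<dots> = (1 + real t) / (2 * \<mu>)"
  proof -
    have "4 * real t + 9 \<noteq> 0" by linarith
    then show ?thesis using assms(3) by (simp add: divide_simps)
  qed
  finally have "gap_at M \<theta> f A t \<ge>
      5 * (spectral_norm A)\<^sup>2 * RY\<^sup>2 / (512 * \<mu> * (4 * real t + 9)\<^sup>2)"
    using gap by linarith
  moreover have "A \<noteq> 0" unfolding A_def by (rule chain_mat_nonzero[OF u v]) (simp add: N_def)
  moreover have "bilinear_spp \<theta> f A"
    unfolding \<theta>_def f_def using assms(3) R by (intro bilinear_spp_ball_data) auto
  moreover have "strongly_convex \<mu> f" unfolding f_def by (rule strongly_convex_quad)
  moreover have "is_ball (Xset \<theta>) RX" "is_ball (Yset \<theta>) RY"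
    using R by (auto simp: is_ball_def \<theta>_def)
  ultimately show ?thesis by blast
qed

theorem theorem2:
  fixes M :: "('n::finite, 'm::finite) fo_method" and t :: nat and L :: real
  assumes "CARD('m) \<le> CARD('n)"
    and "0 < t" and "real t < real CARD('m) / 4 - 2"
    and "0 < L"
    and "first_order_method M"
  shows
    "(\<exists>\<theta> (f :: real ^ 'n \<Rightarrow> real) (A :: real ^ 'n ^ 'm) RX RY.
        bilinear_spp \<theta> f A \<and> Lconst \<theta> = L \<and> A \<noteq> 0 \<and>
        is_ball (Xset \<theta>) RX \<and> is_ball (Yset \<theta>) RY \<and>
        gap_at M \<theta> f A t \<ge>
          L * RX\<^sup>2 / (16 * (4 * real t + 9)\<^sup>2)
          + ((sqrt 2 + 2) / 4) * (spectral_norm A * RX * RY / (4 * real t + 9))) \<and>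
     (\<forall>\<mu>>0. \<exists>\<theta> (f :: real ^ 'n \<Rightarrow> real) (A :: real ^ 'n ^ 'm) RX RY.
        bilinear_spp \<theta> f A \<and> strongly_convex \<mu> f \<and> A \<noteq> 0 \<and>
        is_ball (Xset \<theta>) RX \<and> is_ball (Yset \<theta>) RY \<and>
        gap_at M \<theta> f A t \<ge>
          5 * (spectral_norm A)\<^sup>2 * RY\<^sup>2 / (512 * \<mu> * (4 * real t + 9)\<^sup>2))"
proof -
  have m: "4 * t + 4 \<le> CARD('m)" using assms(3) by linarith
  then have n: "4 * t + 4 \<le> CARD('n)" using assms(1) by linarith
  show ?thesis using convex_case[OF m n assms(4)] strongly_convex_case[OF m n] by blast
qed

end
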